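(* Let $\mathcal{P}(\mathbb{N})$ be Scott's graph model and $C:\mathcal{P}(\mathbb{N})\to\mathcal{P}(\mathbb{N})$, $C(A)=\mathbb{N}-A$, the complement function. (a) The set $\mathcal{P}(\mathbb{N})$ cannot be written as a countable union $\bigcup_{i\in\mathbb{N}}V_i$ such that $C$ is Scott continuous on each $V_i$ (i.e. each restriction $C|_{V_i}:V_i\to\mathcal{P}(\mathbb{N})$ is continuous, where $\mathcal{P}(\mathbb{N})$ has the Scott topology and $V_i$ the subspace topology). (b) The function $C$ is, relative to $\mathcal{P}(\mathbb{N})$, not computable in any function $F:\mathcal{P}(\mathbb{N})\to\mathcal{P}(\mathbb{N})$ with countable image; i.e. for every such $F$, $C$ is not representable in $\mathcal{P}(\mathbb{N})[F]$.
   Context: A partial combinatory algebra (pca) is a set $\mathcal{A}$ with a partial binary application $(a,b)\mapsto ab$ (associating to the left) such that there are $\mathsf{k},\mathsf{s}\in\mathcal{A}$ with, for all $a,b,c$: $\mathsf{k}ab=a$; $\mathsf{s}ab$ is defined; and whenever $(ac)(bc)$ is defined, $\mathsf{s}abc$ is defined and equals $(ac)(bc)$. A partial function $f:\mathcal{A}\to\mathcal{A}$ is representable in $\mathcal{A}$ if there is $a_f\in\mathcal{A}$ with $a_fa=f(a)$ for all $a$ in the domain of $f$. Every pca contains booleans $\mathsf{T},\mathsf{F}$ with a definition-by-cases element $D$ ($D\mathsf{T}ab=a$, $D\mathsf{F}ab=b$), and standard codings $[a,b]$ of pairs and $[a_0,\ldots,a_{n-1}]$ of finite sequences whose basic operations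 (length, projections, appending) are representable; fix such choices. For a pca $\mathcal{A}$ and a partial function $f:\mathcal{A}\to\mathcal{A}$, $\mathcal{A}[f]$ is the pca with underlying set $\mathcal{A}$ and application $\cdot_f$ defined by: $a\cdot_f b=c$ iff there is a finite sequence $e_0,\ldots,e_{n-1}$ in $\mathcal{A}$ (on each of which $f$ is defined) such that $a[b,f(e_0),\ldots,f(e_{i-1})]=[\mathsf{F},e_i]$ for all $i<n$ and $a[b,f(e_0),\ldots,f(e_{n-1})]=[\mathsf{T},c]$. Scott's graph model is the set $\mathcal{P}(\mathbb{N})$ of subsets of $\mathbb{N}$ with application $A\circ B=\{n\mid \exists m\,([m,n]\in A,\ e_m\subseteq B)\}$, where $[\cdot,\cdot]$ is a standard bijective pairing on $\mathbb{N}$ and $e_k$ is the finite set $p$ with $k=\sum_{i\in p}2^i$. The Scott topology on $\mathcal{P}(\mathbb{N})$ has as basis the sets $U_p=\{A\subseteq\mathbb{N}\mid p\subseteq A\}$ for finite $p\subseteq\mathbb{N}$. It is well known that the functions $\mathcal{P}(\mathbb{N})\to\mathcal{P}(\mathbb{N})$ representable in the graph model are exactly the Scott-continuous ones, and that partial representable functions are exactly those continuous on their domain. *)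

theory Defs
  imports "HOL-Analysis.Analysis" "HOL-Library.Nat_Bijection"
begin

section \<open>Partial combinatory algebras\<close>

text \<open>
  A partial application on the type \<open>'a\<close> is a function \<open>'a \<Rightarrow> 'a \<Rightarrow> 'a option\<close>, where \<open>None\<close>
  means undefined. Compound applicative terms are values of type \<open>'a option\<close>; application
  is strict in both arguments.
\<close>

definition papp :: "('a \<Rightarrow> 'a \<Rightarrow> 'a option) \<Rightarrow> 'a option \<Rightarrow> 'a option \<Rightarrow> 'a option" where
  "papp app x y = Option.bind x (\<lambda>a. Option.bind y (\<lambda>b. app a b))"

lemma papp_simps [simp]:
  "papp app (Some a) (Some b) = app a b"
  "papp app None y = None"
  "papp app x None = None"
  by (cases x; simp add: papp_def)+

definition representable :: "('a \<Rightarrow> 'a \<Rightarrow> 'a option) \<Rightarrow> ('a \<Rightarrow> 'a option) \<Rightarrow> bool" where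
  "representable app f \<longleftrightarrow> (\<exists>r. \<forall>a\<in>dom f. app r a = f a)"

locale pca =
  fixes app :: "'a \<Rightarrow> 'a \<Rightarrow> 'a option"
  assumes ex_k_s: "\<exists>k s.
    (\<forall>a b. papp app (app k a) (Some b) = Some a) \<and>
    (\<forall>a b. papp app (app s a) (Some b) \<noteq> None) \<and>
    (\<forall>a b c v. papp app (app a c) (app b c) = Some v \<longrightarrow>
       papp app (papp app (app s a) (Some b)) (Some c) = Some v)"

text \<open>
  A choice of booleans, pairs, numerals and finite sequences. Numerals occur only as the
  values of the length operation and as the indices of the projections of sequences.
\<close>

locale pca_codings = pca app
  for app :: "'a \<Rightarrow> 'a \<Rightarrow> 'a option" +
  fixes tt ff :: 'a
    and pair :: "'a \<Rightarrow> 'a \<Rightarrow> 'a"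
    and num :: "nat \<Rightarrow> 'a"
    and sq :: "'a list \<Rightarrow> 'a"
  assumes ex_cases: "\<exists>d. \<forall>a b.
      papp app (papp app (app d tt) (Some a)) (Some b) = Some a \<and>
      papp app (papp app (app d ff) (Some a)) (Some b) = Some b"
    and ex_pair: "\<exists>p. \<forall>a b. papp app (app p a) (Some b) = Some (pair a b)"
    and ex_fst: "\<exists>p. \<forall>a b. app p (pair a b) = Some a"
    and ex_snd: "\<exists>p. \<forall>a b. app p (pair a b) = Some b"
    and ex_suc: "\<exists>u. \<forall>n. app u (num n) = Some (num (Suc n))"
    and ex_pred: "\<exists>u. \<forall>n. app u (num n) = Some (num (n - 1))"
    and ex_is_zero: "\<exists>u. \<forall>n. app u (num n) = Some (if n = 0 then tt else ff)"
    and ex_length: "\<exists>u. \<forall>xs. app u (sq xs) = Some (num (length xs))"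
    and ex_nth: "\<exists>u. \<forall>xs. \<forall>i<length xs. papp app (app u (num i)) (Some (sq xs)) = Some (xs ! i)"
    and ex_snoc: "\<exists>u. \<forall>xs a. papp app (app u (sq xs)) (Some a) = Some (sq (xs @ [a]))"


section \<open>Adjoining a partial function\<close>

text \<open>
  \<open>dialogue app tt ff pair sq f a b es c\<close>: when computing on input \<open>b\<close>, the element \<open>a\<close> asks
  the queries \<open>es\<close>, in this order, and after the answers of \<open>f\<close> returns the value \<open>c\<close>.
\<close>

definition dialogue ::
  "('a \<Rightarrow> 'a \<Rightarrow> 'a option) \<Rightarrow> 'a \<Rightarrow> 'a \<Rightarrow> ('a \<Rightarrow> 'a \<Rightarrow> 'a) \<Rightarrow> ('a list \<Rightarrow> 'a) \<Rightarrow>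
   ('a \<Rightarrow> 'a option) \<Rightarrow> 'a \<Rightarrow> 'a \<Rightarrow> 'a list \<Rightarrow> 'a \<Rightarrow> bool" where
  "dialogue app tt ff pair sq f a b es c \<longleftrightarrow>
     set es \<subseteq> dom f \<and>
     (\<forall>i<length es. app a (sq (b # map (the \<circ> f) (take i es))) = Some (pair ff (es ! i))) \<and>
     app a (sq (b # map (the \<circ> f) es)) = Some (pair tt c)"

definition app_adjoin ::
  "('a \<Rightarrow> 'a \<Rightarrow> 'a option) \<Rightarrow> 'a \<Rightarrow> 'a \<Rightarrow> ('a \<Rightarrow> 'a \<Rightarrow> 'a) \<Rightarrow> ('a list \<Rightarrow> 'a) \<Rightarrow>
   ('a \<Rightarrow> 'a option) \<Rightarrow> 'a \<Rightarrow> 'a \<Rightarrow> 'a option" where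
  "app_adjoin app tt ff pair sq f a b =
     (if \<exists>c es. dialogue app tt ff pair sq f a b es c
      then Some (THE c. \<exists>es. dialogue app tt ff pair sq f a b es c)
      else None)"

context pca_codings
begin

lemma pair_eq_iff: "pair a b = pair a' b' \<longleftrightarrow> a = a' \<and> b = b'"
  using ex_fst ex_snd by (metis option.inject)

lemma tt_eq_ff_imp:
  assumes "tt = ff"
  shows "(a :: 'a) = b"
proof -
  obtain d where
    "papp app (papp app (app d tt) (Some a)) (Some b) = Some a"
    "papp app (papp app (app d ff) (Some a)) (Some b) = Some b"
    using ex_cases by blast
  with assms show ?thesis by simp
qed

lemma dialogue_prefix:
  assumes "dialogue app tt ff pair sq f a b es c"
    and "dialogue app tt ff pair sq f a b es' c'"
    and "i \<le> length es" "i \<le> length es'"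
  shows "take i es = take i es'"
  using assms(3,4)
proof (induction i)
  case (Suc i)
  then have "take i es = take i es'" by simp
  moreover from this have "es ! i = es' ! i"
    using assms(1,2) Suc.prems unfolding dialogue_def
    by (metis Suc_le_lessD option.inject pair_eq_iff)
  ultimately show ?case
    using Suc.prems by (simp add: take_Suc_conv_app_nth)
qed simp

lemma dialogue_length:
  assumes d: "dialogue app tt ff pair sq f a b es c"
    and d': "dialogue app tt ff pair sq f a b es' c'"
    and "length es < length es'"
  shows "x = (y :: 'a)"
proof -
  have "es = take (length es) es'"
    using dialogue_prefix[OF d d', of "length es"] assms(3) by simp
  then have "pair tt c = pair ff (es' ! length es)"
    using d d' assms(3) unfolding dialogue_def by (metis option.inject)
  then show ?thesis
    using pair_eq_iff tt_eq_ff_imp by blast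
qed

lemma dialogue_unique:
  assumes d: "dialogue app tt ff pair sq f a b es c"
    and d': "dialogue app tt ff pair sq f a b es' c'"
  shows "c = c'"
proof (cases "length es" "length es'" rule: linorder_cases)
  case equal
  then have "es = es'"
    using dialogue_prefix[OF d d', of "length es"] by simp
  then show ?thesis
    using d d' pair_eq_iff unfolding dialogue_def by (metis option.inject)
qed (use dialogue_length[OF d d'] dialogue_length[OF d' d] in blast)+

lemma app_adjoin_eq_Some_iff:
  "app_adjoin app tt ff pair sq f a b = Some c \<longleftrightarrow>
     (\<exists>es. dialogue app tt ff pair sq f a b es c)"
proof
  assume L: "app_adjoin app tt ff pair sq f a b = Some c"
  then obtain c' es where d: "dialogue app tt ff pair sq f a b es c'"
    unfolding app_adjoin_def by (auto split: if_splits)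
  then have "(THE c. \<exists>es. dialogue app tt ff pair sq f a b es c) = c'"
    by (intro the_equality) (auto dest: dialogue_unique)
  with L d show "\<exists>es. dialogue app tt ff pair sq f a b es c"
    unfolding app_adjoin_def by (auto split: if_splits)
next
  assume R: "\<exists>es. dialogue app tt ff pair sq f a b es c"
  then have "(THE c. \<exists>es. dialogue app tt ff pair sq f a b es c) = c"
    by (intro the_equality) (auto dest: dialogue_unique)
  with R show "app_adjoin app tt ff pair sq f a b = Some c"
    unfolding app_adjoin_def by auto
qed

end


section \<open>Scott's graph model\<close>

definition graph_apply :: "nat set \<Rightarrow> nat set \<Rightarrow> nat set" where
  "graph_apply A B = {n. \<exists>m. prod_encode (m, n) \<in> A \<and> set_decode m \<subseteq> B}"

definition graph_app :: "nat set \<Rightarrow> nat set \<Rightarrow> nat set option" where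
  "graph_app A B = Some (graph_apply A B)"

definition scott_basic :: "nat set \<Rightarrow> nat set set" where
  "scott_basic p = {A. p \<subseteq> A}"

definition scott_topology :: "nat set topology" where
  "scott_topology = topology_generated_by {scott_basic p | p. finite p}"

lemma topspace_scott_topology [simp]: "topspace scott_topology = UNIV"
proof -
  have "scott_basic {} = UNIV" by (simp add: scott_basic_def)
  then show ?thesis
    unfolding scott_topology_def topology_generated_by_topspace
    using finite.emptyI by blast
qed

lemma openin_scott_topology:
  "openin scott_topology U \<longleftrightarrow> (\<forall>A\<in>U. \<exists>p. finite p \<and> A \<in> scott_basic p \<and> scott_basic p \<subseteq> U)"
proof
  assume "openin scott_topology U"
  then have "generate_topology_on {scott_basic p | p. finite p} U"
    by (simp add: scott_topology_def openin_topology_generated_by_iff)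
  then show "\<forall>A\<in>U. \<exists>p. finite p \<and> A \<in> scott_basic p \<and> scott_basic p \<subseteq> U"
  proof induction
    case (Int U V)
    show ?case
    proof
      fix A assume "A \<in> U \<inter> V"
      with Int.IH obtain p q where
        "finite p" "A \<in> scott_basic p" "scott_basic p \<subseteq> U"
        "finite q" "A \<in> scott_basic q" "scott_basic q \<subseteq> V" by blast
      moreover have "scott_basic (p \<union> q) = scott_basic p \<inter> scott_basic q"
        by (auto simp: scott_basic_def)
      ultimately show "\<exists>p. finite p \<and> A \<in> scott_basic p \<and> scott_basic p \<subseteq> U \<inter> V"
        by (intro exI[of _ "p \<union> q"]) auto
    qed
  next
    case (UN K)
    then show ?case by (meson Union_iff Union_upper subset_trans)
  next
    case (Basis U)
    then show ?case by blast
  qed simp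
next
  assume R: "\<forall>A\<in>U. \<exists>p. finite p \<and> A \<in> scott_basic p \<and> scott_basic p \<subseteq> U"
  have "\<exists>V. openin scott_topology V \<and> A \<in> V \<and> V \<subseteq> U" if A: "A \<in> U" for A
  proof -
    obtain p where p: "finite p" "A \<in> scott_basic p" "scott_basic p \<subseteq> U"
      using R A by blast
    have "openin scott_topology (scott_basic p)"
      unfolding scott_topology_def using p(1) by (intro topology_generated_by_Basis) blast
    with p show ?thesis by blast
  qed
  then show "openin scott_topology U"
    by (subst openin_subopen) blast
qed


subsection \<open>The graph model is a pca, and codings exist\<close>

definition finitary :: "(nat set \<Rightarrow> nat set) \<Rightarrow> bool" where
  "finitary f \<longleftrightarrow> (\<forall>X n. n \<in> f X \<longleftrightarrow> (\<exists>p. finite p \<and> p \<subseteq> X \<and> n \<in> f p))"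

definition graph_of :: "(nat set \<Rightarrow> nat set) \<Rightarrow> nat set" where
  "graph_of f = {prod_encode (m, n) | m n. n \<in> f (set_decode m)}"

lemma finitary_mono: "finitary f \<Longrightarrow> X \<subseteq> Y \<Longrightarrow> f X \<subseteq> f Y"
  unfolding finitary_def by (meson order_trans subsetI)

lemma finitaryI_affine:
  assumes "\<And>X n. n \<in> f X \<longleftrightarrow> n \<in> K \<or> (\<exists>x\<in>X. R x n)"
  shows "finitary f"
  unfolding finitary_def
proof (intro allI iffI)
  fix X n assume "n \<in> f X"
  then consider "n \<in> K" | x where "x \<in> X" "R x n" using assms by blast
  then show "\<exists>p. finite p \<and> p \<subseteq> X \<and> n \<in> f p"
  proof cases
    case 1
    then show ?thesis using assms by (intro exI[of _ "{}"]) simp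
  next
    case 2
    then show ?thesis using assms by (intro exI[of _ "{x}"]) auto
  qed
qed (use assms in blast)

lemma finitary_graph_apply:
  assumes "finitary f" "finitary g"
  shows "finitary (\<lambda>X. graph_apply (f X) (g X))"
  unfolding finitary_def
proof (intro allI iffI)
  fix X n assume "n \<in> graph_apply (f X) (g X)"
  then obtain m where m: "prod_encode (m, n) \<in> f X" "set_decode m \<subseteq> g X"
    by (auto simp: graph_apply_def)
  obtain p where p: "finite p" "p \<subseteq> X" "prod_encode (m, n) \<in> f p"
    using m(1) assms(1) unfolding finitary_def by blast
  have "\<forall>y\<in>set_decode m. \<exists>q. finite q \<and> q \<subseteq> X \<and> y \<in> g q"
    using m(2) assms(2) unfolding finitary_def by blast
  then obtain q where q: "\<And>y. y \<in> set_decode m \<Longrightarrow> finite (q y) \<and> q y \<subseteq> X \<and> y \<in> g (q y)"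
    by metis
  let ?r = "p \<union> (\<Union>y\<in>set_decode m. q y)"
  have "prod_encode (m, n) \<in> f ?r"
    using p(3) finitary_mono[OF assms(1), of p ?r] by blast
  moreover have "set_decode m \<subseteq> g ?r"
  proof
    fix y assume y: "y \<in> set_decode m"
    then have "q y \<subseteq> ?r" by blast
    from finitary_mono[OF assms(2) this] show "y \<in> g ?r" using q[OF y] by blast
  qed
  ultimately have "n \<in> graph_apply (f ?r) (g ?r)"
    by (auto simp: graph_apply_def)
  moreover have "finite ?r" using p q by auto
  moreover have "?r \<subseteq> X" using p q by auto
  ultimately show "\<exists>p. finite p \<and> p \<subseteq> X \<and> n \<in> graph_apply (f p) (g p)" by blast
next
  fix X n assume "\<exists>p. finite p \<and> p \<subseteq> X \<and> n \<in> graph_apply (f p) (g p)"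
  then obtain p where "p \<subseteq> X" "n \<in> graph_apply (f p) (g p)" by blast
  then show "n \<in> graph_apply (f X) (g X)"
    using finitary_mono[OF assms(1) \<open>p \<subseteq> X\<close>] finitary_mono[OF assms(2) \<open>p \<subseteq> X\<close>]
    unfolding graph_apply_def by blast
qed

lemma finitary_const: "finitary (\<lambda>X. K)"
  by (rule finitaryI_affine[where K = K and R = "\<lambda>_ _. False"]) simp

lemma finitary_id: "finitary (\<lambda>X. X)"
  by (rule finitaryI_affine[where K = "{}" and R = "(=)"]) simp

lemma finitary_graph_of:
  assumes "\<And>Y. finitary (\<lambda>X. f X Y)"
  shows "finitary (\<lambda>X. graph_of (f X))"
proof -
  have *: "prod_encode (m, n) \<in> graph_of (f X) \<longleftrightarrow> n \<in> f X (set_decode m)" for m n X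
    by (auto simp: graph_of_def)
  show ?thesis
    unfolding finitary_def
  proof (intro allI)
    fix X k
    obtain m n where k: "k = prod_encode (m, n)"
      by (metis prod_decode_inverse surj_pair)
    show "k \<in> graph_of (f X) \<longleftrightarrow> (\<exists>p. finite p \<and> p \<subseteq> X \<and> k \<in> graph_of (f p))"
      using assms[of "set_decode m"] unfolding k * finitary_def by blast
  qed
qed

lemma graph_apply_graph_of [simp]:
  assumes "finitary f"
  shows "graph_apply (graph_of f) X = f X"
proof -
  have "n \<in> graph_apply (graph_of f) X \<longleftrightarrow> n \<in> f X" for n
  proof -
    have "n \<in> graph_apply (graph_of f) X \<longleftrightarrow> (\<exists>m. set_decode m \<subseteq> X \<and> n \<in> f (set_decode m))"
      by (auto simp: graph_apply_def graph_of_def)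
    also have "\<dots> \<longleftrightarrow> (\<exists>p. finite p \<and> p \<subseteq> X \<and> n \<in> f p)"
      by (metis finite_set_decode set_encode_inverse)
    finally show ?thesis
      using assms unfolding finitary_def by blast
  qed
  then show ?thesis by blast
qed

lemma graph_represents1:
  assumes "finitary f"
  shows "\<exists>u. \<forall>X. graph_app u X = Some (f X)"
  using graph_apply_graph_of[OF assms] unfolding graph_app_def by blast

lemma graph_represents2:
  assumes "\<And>Y. finitary (\<lambda>X. f X Y)" "\<And>X. finitary (f X)"
  shows "\<exists>u. \<forall>X Y. papp graph_app (graph_app u X) (Some Y) = Some (f X Y)"
proof -
  let ?u = "graph_of (\<lambda>X. graph_of (f X))"
  have "graph_apply (graph_apply ?u X) Y = f X Y" for X Y
    by (simp add: finitary_graph_of assms)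
  then show ?thesis unfolding graph_app_def by (intro exI[of _ ?u]) simp
qed

lemma graph_represents3:
  assumes "\<And>Y Z. finitary (\<lambda>X. f X Y Z)" "\<And>X Z. finitary (\<lambda>Y. f X Y Z)" "\<And>X Y. finitary (f X Y)"
  shows "\<exists>u. \<forall>X Y Z. papp graph_app (papp graph_app (graph_app u X) (Some Y)) (Some Z) = Some (f X Y Z)"
proof -
  let ?u = "graph_of (\<lambda>X. graph_of (\<lambda>Y. graph_of (f X Y)))"
  have "graph_apply (graph_apply (graph_apply ?u X) Y) Z = f X Y Z" for X Y Z
    by (simp add: finitary_graph_of assms)
  then show ?thesis unfolding graph_app_def by (intro exI[of _ ?u]) simp
qed

lemma pca_graph_app: "pca graph_app"
proof
  obtain k where "\<forall>X Y. papp graph_app (graph_app k X) (Some Y) = Some X"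
    using graph_represents2[of "\<lambda>X Y. X"] finitary_const finitary_id by blast
  moreover have "\<exists>s. \<forall>X Y Z. papp graph_app (papp graph_app (graph_app s X) (Some Y)) (Some Z) =
      Some (graph_apply (graph_apply X Z) (graph_apply Y Z))"
    by (rule graph_represents3; intro finitary_graph_apply finitary_const finitary_id)
  then obtain s where "\<forall>X Y Z. papp graph_app (papp graph_app (graph_app s X) (Some Y)) (Some Z) =
      Some (graph_apply (graph_apply X Z) (graph_apply Y Z))" ..
  moreover have "papp graph_app (graph_app s X) (Some Y) \<noteq> None" for s X Y
    by (simp add: graph_app_def)
  ultimately show "\<exists>k s.
    (\<forall>a b. papp graph_app (graph_app k a) (Some b) = Some a) \<and>
    (\<forall>a b. papp graph_app (graph_app s a) (Some b) \<noteq> None) \<and>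
    (\<forall>a b c v. papp graph_app (graph_app a c) (graph_app b c) = Some v \<longrightarrow>
       papp graph_app (papp graph_app (graph_app s a) (Some b)) (Some c) = Some v)"
    by (intro exI[of _ k] exI[of _ s]) (auto simp: graph_app_def)
qed

definition graph_pair :: "nat set \<Rightarrow> nat set \<Rightarrow> nat set" where
  "graph_pair A B = (\<lambda>n. 2 * n) ` A \<union> (\<lambda>n. 2 * n + 1) ` B"

definition graph_seq :: "nat set list \<Rightarrow> nat set" where
  "graph_seq xs = insert (prod_encode (0, length xs))
     {prod_encode (Suc i, n) | i n. i < length xs \<and> n \<in> xs ! i}"

lemma pca_codings_graph_app:
  "pca_codings graph_app {0} {1} graph_pair (\<lambda>n. {n}) graph_seq"
proof -
  interpret pca graph_app by (rule pca_graph_app)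
  show ?thesis
  proof
    let ?d = "\<lambda>X A B. {n. 0 \<in> X \<and> n \<in> A \<or> Suc 0 \<in> X \<and> n \<in> B}"
    have "finitary (\<lambda>X. ?d X A B)" for A B
      by (rule finitaryI_affine[where K = "{}" and R = "\<lambda>x n. x = 0 \<and> n \<in> A \<or> x = Suc 0 \<and> n \<in> B"]) auto
    moreover have "finitary (\<lambda>A. ?d X A B)" for X B
      by (rule finitaryI_affine[where K = "{n. Suc 0 \<in> X \<and> n \<in> B}" and R = "\<lambda>x n. x = n \<and> 0 \<in> X"]) auto
    moreover have "finitary (\<lambda>B. ?d X A B)" for X A
      by (rule finitaryI_affine[where K = "{n. 0 \<in> X \<and> n \<in> A}" and R = "\<lambda>x n. x = n \<and> Suc 0 \<in> X"]) auto
    ultimately obtain d where "\<forall>X A B.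
        papp graph_app (papp graph_app (graph_app d X) (Some A)) (Some B) = Some (?d X A B)"
      using graph_represents3[of ?d] by blast
    then show "\<exists>d. \<forall>a b.
        papp graph_app (papp graph_app (graph_app d {0}) (Some a)) (Some b) = Some a \<and>
        papp graph_app (papp graph_app (graph_app d {1}) (Some a)) (Some b) = Some b"
      by (intro exI[of _ d]) simp
  next
    have "finitary (\<lambda>A. graph_pair A B)" for B
      by (rule finitaryI_affine[where K = "(\<lambda>n. 2 * n + 1) ` B" and R = "\<lambda>x n. n = 2 * x"])
        (auto simp: graph_pair_def)
    moreover have "finitary (graph_pair A)" for A
      by (rule finitaryI_affine[where K = "(\<lambda>n. 2 * n) ` A" and R = "\<lambda>x n. n = 2 * x + 1"])
        (auto simp: graph_pair_def)
    ultimately show "\<exists>p. \<forall>a b. papp graph_app (graph_app p a) (Some b) = Some (graph_pair a b)"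
      by (rule graph_represents2)
  next
    have "finitary (\<lambda>X. {n. 2 * n \<in> X})"
      by (rule finitaryI_affine[where K = "{}" and R = "\<lambda>x n. x = 2 * n"]) auto
    then obtain u where "\<forall>X. graph_app u X = Some {n. 2 * n \<in> X}"
      using graph_represents1 by blast
    moreover have "{n. 2 * n \<in> graph_pair a b} = a" for a b
      by (auto simp: graph_pair_def) presburger
    ultimately show "\<exists>p. \<forall>a b. graph_app p (graph_pair a b) = Some a"
      by (intro exI[of _ u]) simp
  next
    have "finitary (\<lambda>X. {n. 2 * n + 1 \<in> X})"
      by (rule finitaryI_affine[where K = "{}" and R = "\<lambda>x n. x = 2 * n + 1"]) auto
    then obtain u where "\<forall>X. graph_app u X = Some {n. 2 * n + 1 \<in> X}"
      using graph_represents1 by blast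
    moreover have "{n. 2 * n + 1 \<in> graph_pair a b} = b" for a b
      by (auto simp: graph_pair_def) presburger
    ultimately show "\<exists>p. \<forall>a b. graph_app p (graph_pair a b) = Some b"
      by (intro exI[of _ u]) simp
  next
    have "finitary (\<lambda>X. Suc ` X)"
      by (rule finitaryI_affine[where K = "{}" and R = "\<lambda>x n. n = Suc x"]) auto
    then obtain u where "\<forall>X. graph_app u X = Some (Suc ` X)"
      using graph_represents1 by blast
    then show "\<exists>u. \<forall>n. graph_app u {n} = Some {Suc n}"
      by (intro exI[of _ u]) simp
  next
    have "finitary (\<lambda>X. (\<lambda>n. n - 1) ` X)"
      by (rule finitaryI_affine[where K = "{}" and R = "\<lambda>x n. n = x - 1"]) auto
    then obtain u where "\<forall>X. graph_app u X = Some ((\<lambda>n. n - 1) ` X)"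
      using graph_represents1 by blast
    then show "\<exists>u. \<forall>n. graph_app u {n} = Some {n - 1}"
      by (intro exI[of _ u]) simp
  next
    have "finitary (\<lambda>X. (\<lambda>n. if n = 0 then 0 else 1) ` X)"
      by (rule finitaryI_affine[where K = "{}" and R = "\<lambda>x n. n = (if x = 0 then 0 else 1)"])
        blast
    then obtain u where "\<forall>X. graph_app u X = Some ((\<lambda>n. if n = 0 then 0 else 1) ` X)"
      using graph_represents1 by blast
    then show "\<exists>u. \<forall>n. graph_app u {n} = Some (if n = 0 then {0} else {1})"
      by (intro exI[of _ u]) simp
  next
    have "finitary (\<lambda>X. {n. prod_encode (0, n) \<in> X})"
      by (rule finitaryI_affine[where K = "{}" and R = "\<lambda>x n. x = prod_encode (0, n)"]) auto
    then obtain u where "\<forall>X. graph_app u X = Some {n. prod_encode (0, n) \<in> X}"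
      using graph_represents1 by blast
    moreover have "{n. prod_encode (0, n) \<in> graph_seq xs} = {length xs}" for xs
      by (auto simp: graph_seq_def)
    ultimately show "\<exists>u. \<forall>xs. graph_app u (graph_seq xs) = Some {length xs}"
      by (intro exI[of _ u]) simp
  next
    let ?f = "\<lambda>I X. {n. \<exists>i\<in>I. prod_encode (Suc i, n) \<in> X}"
    have "finitary (\<lambda>I. ?f I X)" for X
      by (rule finitaryI_affine[where K = "{}" and R = "\<lambda>i n. prod_encode (Suc i, n) \<in> X"]) auto
    moreover have "finitary (?f I)" for I
      by (rule finitaryI_affine[where K = "{}" and R = "\<lambda>x n. \<exists>i\<in>I. x = prod_encode (Suc i, n)"]) auto
    ultimately obtain u where "\<forall>I X. papp graph_app (graph_app u I) (Some X) = Some (?f I X)"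
      using graph_represents2[of ?f] by blast
    moreover have "?f {i} (graph_seq xs) = xs ! i" if "i < length xs" for i xs
      using that by (auto simp: graph_seq_def)
    ultimately show "\<exists>u. \<forall>xs. \<forall>i<length xs.
        papp graph_app (graph_app u {i}) (Some (graph_seq xs)) = Some (xs ! i)"
      by (intro exI[of _ u]) simp
  next
    let ?f = "\<lambda>X A.
      {k. (\<exists>n. k = prod_encode (0, Suc n) \<and> prod_encode (0, n) \<in> X) \<or>
          (\<exists>i n. k = prod_encode (Suc i, n) \<and> k \<in> X) \<or>
          (\<exists>i n. k = prod_encode (Suc i, n) \<and> prod_encode (0, i) \<in> X \<and> n \<in> A)}"
    have "finitary (\<lambda>X. ?f X A)" for A
      by (rule finitaryI_affine[where K = "{}" and R = "\<lambda>x k.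
            (\<exists>n. k = prod_encode (0, Suc n) \<and> x = prod_encode (0, n)) \<or>
            (\<exists>i n. k = prod_encode (Suc i, n) \<and> x = k) \<or>
            (\<exists>i n. k = prod_encode (Suc i, n) \<and> x = prod_encode (0, i) \<and> n \<in> A)"]) blast
    moreover have "finitary (?f X)" for X
      by (rule finitaryI_affine[where K = "{k.
            (\<exists>n. k = prod_encode (0, Suc n) \<and> prod_encode (0, n) \<in> X) \<or>
            (\<exists>i n. k = prod_encode (Suc i, n) \<and> k \<in> X)}" and R = "\<lambda>x k.
            (\<exists>i. k = prod_encode (Suc i, x) \<and> prod_encode (0, i) \<in> X)"]) blast
    ultimately obtain u where "\<forall>X A. papp graph_app (graph_app u X) (Some A) = Some (?f X A)"
      using graph_represents2[of ?f] by blast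
    moreover have "?f (graph_seq xs) a = graph_seq (xs @ [a])" for xs a
    proof -
      have "prod_encode (j, n) \<in> ?f (graph_seq xs) a \<longleftrightarrow> prod_encode (j, n) \<in> graph_seq (xs @ [a])"
        for j n
        by (cases j) (auto simp: graph_seq_def nth_append less_Suc_eq)
      then show ?thesis
        by (metis (no_types, lifting) prod_decode_inverse surj_pair subsetI subset_antisym)
    qed
    ultimately show "\<exists>u. \<forall>xs a.
        papp graph_app (graph_app u (graph_seq xs)) (Some a) = Some (graph_seq (xs @ [a]))"
      by (intro exI[of _ u]) simp
  qed
qed


section \<open>The complement function\<close>

definition compl_fun :: "nat set \<Rightarrow> nat set" where
  "compl_fun A = UNIV - A"

end

theory Submission
  imports Defs
begin

text \<open>
  A map that is monotone for inclusion, in particular a Scott continuous one, can agree with the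
  complement only on an antichain. But \<open>\<P>(\<nat>)\<close> contains a chain of order type \<open>\<real>\<close> (the left Dedekind
  cuts of \<open>\<rat>\<close>), so it is not a countable union of antichains. For (b), once the finite list of
  oracle answers is fixed, the result of a dialogue is a monotone function of the input, and an
  oracle with countable image admits only countably many such lists.
\<close>

text \<open>A cover by countably many antichains is recast as a colouring, so that both parts can
  use it: the colour is the index of a piece in (a) and the list of oracle answers in (b).\<close>

lemma countable_colouring_not_antichains:
  fixes c :: "nat set \<Rightarrow> 'b"
  assumes "countable (range c)"
  obtains A B where "A \<subset> B" "c A = c B"
proof -
  obtain q :: "nat \<Rightarrow> rat" where q: "surj q"
    using surj_nat_to_rat_surj by blast
  \<comment> \<open>The left Dedekind cut of \<open>x\<close>, carried over to the naturals by the
    enumeration \<open>q\<close>; a rational strictly between \<open>x\<close> and \<open>y\<close>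
    makes the inclusion of cuts proper.\<close>
  define cut where "cut x = {n. real_of_rat (q n) < x}" for x
  have cut: "cut x \<subset> cut y" if "x < y" for x y :: real
  proof -
    obtain r where r: "x < real_of_rat r" "real_of_rat r < y"
      using of_rat_dense[OF \<open>x < y\<close>] by blast
    obtain n where "q n = r" using q by (metis surjD)
    then have "n \<in> cut y - cut x" using r by (simp add: cut_def)
    moreover have "cut x \<subseteq> cut y" using that by (auto simp: cut_def)
    ultimately show ?thesis by blast
  qed
  have "countable (range (c \<circ> cut))"
    by (rule countable_subset[OF _ assms]) auto
  then have "\<not> inj (c \<circ> cut)"
    using countable_image_inj_on uncountable_UNIV_real by blast
  then obtain x y where "x < y" "c (cut x) = c (cut y)"
    unfolding inj_def by (metis comp_apply linorder_less_linear)
  with cut that show thesis by blast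
qed

text \<open>Scott open sets are upward closed, and the preimage of \<open>scott_basic {n}\<close> is
  the trace on \<open>V\<close> of such a set.\<close>

lemma continuous_map_scott_mono:
  assumes f: "continuous_map (subtopology scott_topology V) scott_topology f"
    and "A \<in> V" "B \<in> V" "A \<subseteq> B"
  shows "f A \<subseteq> f B"
proof
  fix n assume n: "n \<in> f A"
  have "openin scott_topology (scott_basic {n})"
    unfolding openin_scott_topology by blast
  then have "openin (subtopology scott_topology V)
      {x \<in> topspace (subtopology scott_topology V). f x \<in> scott_basic {n}}"
    using f by (rule openin_continuous_map_preimage[rotated])
  then obtain U where U: "openin scott_topology U"
    and eq: "{x \<in> V. f x \<in> scott_basic {n}} = U \<inter> V"
    by (auto simp: openin_subtopology)
  have "A \<in> U" using n \<open>A \<in> V\<close> eq by (auto simp: scott_basic_def)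
  then have "B \<in> U"
    using U \<open>A \<subseteq> B\<close> unfolding openin_scott_topology scott_basic_def by blast
  then show "n \<in> f B" using eq \<open>B \<in> V\<close> by (auto simp: scott_basic_def)
qed

lemma graph_apply_mono: "A \<subseteq> A' \<Longrightarrow> B \<subseteq> B' \<Longrightarrow> graph_apply A B \<subseteq> graph_apply A' B'"
  unfolding graph_apply_def by blast

context
  fixes tt ff pair num sq
  assumes codings: "pca_codings graph_app tt ff pair num sq"
begin

text \<open>Appending is represented by some element, and graph application is monotone in both
  arguments; so this holds for every choice of coding.\<close>

lemma sq_snoc_mono:
  assumes "sq xs \<subseteq> sq xs'" "a \<subseteq> a'"
  shows "sq (xs @ [a]) \<subseteq> sq (xs' @ [a'])"
proof -
  obtain u where "\<And>xs a. sq (xs @ [a]) = graph_apply (graph_apply u (sq xs)) a"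
    using pca_codings.ex_snoc[OF codings] by (auto simp: graph_app_def)
  then show ?thesis
    using assms by (simp add: graph_apply_mono)
qed

text \<open>The input of a dialogue sits at the head of the list, while the representable operation
  appends at the end; hence the induction from the right.\<close>

lemma sq_Cons_mono:
  assumes "a \<subseteq> a'"
  shows "sq (a # ys) \<subseteq> sq (a' # ys)"
proof (induction ys rule: rev_induct)
  case Nil
  show ?case using sq_snoc_mono[of "[]" "[]"] assms by simp
next
  case (snoc y ys)
  then show ?case using sq_snoc_mono[of "a # ys" "a' # ys" y y] by simp
qed

lemma pair_reflects_snd:
  assumes "pair a b \<subseteq> pair a' b'"
  shows "b \<subseteq> b'"
proof -
  obtain u where "\<And>a b. b = graph_apply u (pair a b)"
    using pca_codings.ex_snd[OF codings] by (auto simp: graph_app_def)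
  then show ?thesis
    using assms graph_apply_mono[of u u] by (metis order_refl)
qed

text \<open>With equal answers, the two final calls of \<open>r\<close> differ only in the input;
  the queries themselves may differ.\<close>

lemma dialogue_mono:
  assumes "dialogue graph_app tt ff pair sq f r b es c"
    and "dialogue graph_app tt ff pair sq f r b' es' c'"
    and "map (the \<circ> f) es = map (the \<circ> f) es'" "b \<subseteq> b'"
  shows "c \<subseteq> c'"
proof -
  have "pair tt c = graph_apply r (sq (b # map (the \<circ> f) es))"
    "pair tt c' = graph_apply r (sq (b' # map (the \<circ> f) es))"
    using assms(1-3) by (auto simp: dialogue_def graph_app_def)
  then show ?thesis
    using graph_apply_mono[OF order_refl sq_Cons_mono[OF assms(4)]]
    by (metis pair_reflects_snd)
qed

lemma compl_not_representable_adjoin: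
  assumes "countable (range F)"
  shows "\<not> representable (app_adjoin graph_app tt ff pair sq (\<lambda>A. Some (F A)))
    (\<lambda>A. Some (compl_fun A))"
proof
  let ?f = "\<lambda>A. Some (F A)"
  assume "representable (app_adjoin graph_app tt ff pair sq ?f) (\<lambda>A. Some (compl_fun A))"
  then obtain r where "\<And>A. app_adjoin graph_app tt ff pair sq ?f r A = Some (compl_fun A)"
    unfolding representable_def by auto
  then have "\<forall>A. \<exists>es. dialogue graph_app tt ff pair sq ?f r A es (compl_fun A)"
    unfolding pca_codings.app_adjoin_eq_Some_iff[OF codings] by blast
  then obtain es where es: "\<And>A. dialogue graph_app tt ff pair sq ?f r A (es A) (compl_fun A)"
    by metis
  have "countable (range (\<lambda>A. map (the \<circ> ?f) (es A)))"
    \<comment> \<open>All answer lists are finite lists over the countable set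
      \<open>range F\<close>.\<close>
    by (rule countable_subset[OF _ countable_lists[OF assms]]) auto
  then obtain A B where "A \<subset> B" "map (the \<circ> ?f) (es A) = map (the \<circ> ?f) (es B)"
    by (rule countable_colouring_not_antichains)
  then have "compl_fun A \<subseteq> compl_fun B"
    using dialogue_mono[OF es es] by blast
  with \<open>A \<subset> B\<close> show False by (auto simp: compl_fun_def)
qed

end

theorem theorem3p2:
  shows "(\<nexists>V :: nat \<Rightarrow> nat set set.
            (\<Union>i. V i) = UNIV \<and>
            (\<forall>i. continuous_map (subtopology scott_topology (V i)) scott_topology compl_fun))
       \<and> (\<forall>tt ff pair num sq. pca_codings graph_app tt ff pair num sq \<longrightarrow>
            (\<forall>F :: nat set \<Rightarrow> nat set. countable (range F) \<longrightarrow>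
               \<not> representable (app_adjoin graph_app tt ff pair sq (\<lambda>A. Some (F A)))
                    (\<lambda>A. Some (compl_fun A))))"
proof (intro conjI notI allI impI)
  assume "\<exists>V. (\<Union>i::nat. V i) = UNIV \<and>
    (\<forall>i. continuous_map (subtopology scott_topology (V i)) scott_topology compl_fun)"
  then obtain V :: "nat \<Rightarrow> nat set set" where "(\<Union>i. V i) = UNIV"
    and cont: "\<And>i. continuous_map (subtopology scott_topology (V i)) scott_topology compl_fun"
    by blast
  then have "\<forall>A. \<exists>i. A \<in> V i" by blast
  \<comment> \<open>The colour of \<open>A\<close> is the index of a chosen piece containing
    it.\<close>
  then obtain c where c: "\<And>A. A \<in> V (c A)" by metis
  obtain A B where "A \<subset> B" "c A = c B"
    by (rule countable_colouring_not_antichains[of c]) auto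
  then have "compl_fun A \<subseteq> compl_fun B"
    using continuous_map_scott_mono[OF cont, of A "c A" B] c[of A] c[of B] by auto
  with \<open>A \<subset> B\<close> show False by (auto simp: compl_fun_def)
qed (use compl_not_representable_adjoin in blast)

end
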